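(* Let $\widetilde\Xi = \left(\begin{bmatrix} G\\ \tilde G\end{bmatrix}, L, \begin{bmatrix} K\\ \tilde K\end{bmatrix}\right)$ be a scattering passive boundary node on Hilbert spaces $(\mathcal U\oplus\tilde{\mathcal U},\mathcal X,\mathcal Y\oplus\tilde{\mathcal Y})$ with solution space $\tilde{\mathcal Z}$. Put $\mathcal Z := \ker(\tilde G)\subset\tilde{\mathcal Z}$. Then $\Xi := (G|_{\mathcal Z}, L|_{\mathcal Z}, K|_{\mathcal Z})$ is a scattering passive boundary node on $(\mathcal U,\mathcal X,\mathcal Y)$ with solution space $\mathcal Z$. Both $\widetilde\Xi$ and $\Xi$ have the same semigroup generator, which equals $L|_{\ker(G)\cap\ker(\tilde G)}$. If $\widetilde\Xi$ is a strong node, then so is $\Xi$.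
   Context: $\mathbb R^+=[0,\infty)$, all Hilbert spaces are complex, and $\oplus$ denotes the orthogonal direct sum. Internally well-posed boundary node: a triple $\Xi=(G,L,K)$ of linear operators with the same domain $\mathcal Z\subset\mathcal X$ (the solution space) and with values in the Hilbert spaces $\mathcal U$, $\mathcal X$, $\mathcal Y$, respectively, is an internally well-posed boundary node on $(\mathcal U,\mathcal X,\mathcal Y)$ if (1) $\begin{bmatrix}G\\ L\\ K\end{bmatrix}$ is a closed operator from $\mathcal X$ into $\mathcal U\times\mathcal X\times\mathcal Y$ with domain $\mathcal Z$; (2) $G$ is surjective and $\ker(G)$ is dense in $\mathcal X$; (3) $L|_{\ker(G)}$, as an unbounded operator in $\mathcal X$ with domain $\ker(G)$, generates a strongly continuous semigroup on $\mathcal X$. The operator $L|_{\ker(G)}$ is called the semigroup generator. The node is strong if, in addition, $L$ is a closed operator on $\mathcal X$ with domain $\mathcal Z$. The space $\mathcal Z$ is a Hilbert space with the graph norm $\|z\|_{\mathcal Z}^2=\|z\|_{\mathcal X}^2+\|Lz\|_{\mathcal X}^2+\|Gz\|_{\mathcal U}^2+\|Kz\|_{\mathcal Y}^2$. For such a node, for all $z_0\in\mathcal Z$ and $u\in C^2(\mathbb R^+;\mathcal U)$ with $Gz_0=u(0)$, the equations $u(t)=Gz(t)$, $\dot z(t)=Lz(t)$, $z(0)=z_0$ have a unique (``smooth'') solution $z\in C^1(\mathbb R^+;\mathcal X)\cap C(\mathbb R^+;\mathcal Z)$; set $y(t)=Kz(t)$. A scattering passive boundary node is an internally well-posed boundary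 node such that all smooth solutions satisfy $\frac{d}{dt}\|z(t)\|_{\mathcal X}^2+\|y(t)\|_{\mathcal Y}^2\le\|u(t)\|_{\mathcal U}^2$ for all $t\in\mathbb R^+$. *)

theory Defs
  imports "HOL-Analysis.Analysis"
begin

text \<open>
  Complex Hilbert spaces. The library provides only the real notions, so the complex
  structure is added on top of a complete \<^class>\<open>real_inner\<close> space whose (real) inner product
  is the real part of the complex one; in particular the library norm is the Hilbert space norm.
  The complex inner product is linear in its first argument.
\<close>

class complex_hilbert = real_inner + complete_space +
  fixes scaleC :: "complex \<Rightarrow> 'a \<Rightarrow> 'a" (infixr "*\<^sub>C" 75)
    and cinner :: "'a \<Rightarrow> 'a \<Rightarrow> complex"
  assumes scaleC_add_right: "c *\<^sub>C (x + y) = c *\<^sub>C x + c *\<^sub>C y"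
    and scaleC_add_left: "(c + d) *\<^sub>C x = c *\<^sub>C x + d *\<^sub>C x"
    and scaleC_scaleC: "c *\<^sub>C (d *\<^sub>C x) = (c * d) *\<^sub>C x"
    and scaleC_one: "1 *\<^sub>C x = x"
    and scaleR_scaleC: "r *\<^sub>R x = complex_of_real r *\<^sub>C x"
    and cinner_commute: "cinner x y = cnj (cinner y x)"
    and cinner_add_left: "cinner (x + y) z = cinner x z + cinner y z"
    and cinner_scaleC_left: "cinner (c *\<^sub>C x) y = c * cinner x y"
    and inner_eq_Re_cinner: "inner x y = Re (cinner x y)"

interpretation complex_vector: vector_space "scaleC :: complex \<Rightarrow> 'a \<Rightarrow> 'a::complex_hilbert"
  by unfold_locales (simp_all add: scaleC_add_right scaleC_add_left scaleC_scaleC scaleC_one)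

instantiation complex :: complex_hilbert
begin

definition scaleC_complex :: "complex \<Rightarrow> complex \<Rightarrow> complex"
  where "scaleC_complex c x = c * x"

definition cinner_complex :: "complex \<Rightarrow> complex \<Rightarrow> complex"
  where "cinner_complex x y = x * cnj y"

instance
  by standard
    (simp_all add: scaleC_complex_def cinner_complex_def algebra_simps scaleR_conv_of_real
      inner_complex_def)

end

text \<open>
  The orthogonal direct sum of two Hilbert spaces is the product type: the library norm on it is
  \<open>norm (x, y) = sqrt ((norm x)\<^sup>2 + (norm y)\<^sup>2)\<close>.
\<close>

instantiation prod :: (complex_hilbert, complex_hilbert) complex_hilbert
begin

definition scaleC_prod :: "complex \<Rightarrow> 'a \<times> 'b \<Rightarrow> 'a \<times> 'b"
  where "scaleC_prod c x = (c *\<^sub>C fst x, c *\<^sub>C snd x)"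

definition cinner_prod :: "'a \<times> 'b \<Rightarrow> 'a \<times> 'b \<Rightarrow> complex"
  where "cinner_prod x y = cinner (fst x) (fst y) + cinner (snd x) (snd y)"

instance
proof
  fix x y :: "'a \<times> 'b"
  show "cinner x y = cnj (cinner y x)"
    unfolding cinner_prod_def by (simp flip: cinner_commute)
qed (simp_all add: scaleC_prod_def cinner_prod_def scaleC_add_right scaleC_add_left scaleC_scaleC
      scaleC_one scaleR_scaleC cinner_add_left cinner_scaleC_left inner_eq_Re_cinner inner_prod_def
      algebra_simps scaleR_prod_def)

end

text \<open>
  An unbounded operator with domain \<open>D\<close> is a total function together with the set \<open>D\<close>; only its
  values on \<open>D\<close> matter, so restricting an operator to a smaller domain just replaces \<open>D\<close>.
  Two operators, each with its domain, are equal iff their graphs are.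
\<close>

definition op_graph :: "'a set \<Rightarrow> ('a \<Rightarrow> 'b) \<Rightarrow> ('a \<times> 'b) set"
  where "op_graph D A = (\<lambda>x. (x, A x)) ` D"

definition op_kernel :: "'a set \<Rightarrow> ('a \<Rightarrow> 'b::zero) \<Rightarrow> 'a set"
  where "op_kernel D A = {x \<in> D. A x = 0}"

definition linear_operator ::
    "'a::complex_hilbert set \<Rightarrow> ('a \<Rightarrow> 'b::complex_hilbert) \<Rightarrow> bool"
  where "linear_operator D A \<longleftrightarrow>
    complex_vector.subspace D \<and>
    (\<forall>x\<in>D. \<forall>y\<in>D. A (x + y) = A x + A y) \<and>
    (\<forall>c. \<forall>x\<in>D. A (c *\<^sub>C x) = c *\<^sub>C A x)"

definition closed_operator ::
    "'a::complex_hilbert set \<Rightarrow> ('a \<Rightarrow> 'b::complex_hilbert) \<Rightarrow> bool"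
  where "closed_operator D A \<longleftrightarrow> linear_operator D A \<and> closed (op_graph D A)"

text \<open>Only the values \<open>T t\<close> with \<open>t \<ge> 0\<close> are relevant.\<close>

definition C0_semigroup :: "(real \<Rightarrow> 'a \<Rightarrow> 'a::complex_hilbert) \<Rightarrow> bool"
  where "C0_semigroup T \<longleftrightarrow>
    (\<forall>t\<ge>0. bounded_linear (T t) \<and> (\<forall>c x. T t (c *\<^sub>C x) = c *\<^sub>C T t x)) \<and>
    (\<forall>x. T 0 x = x) \<and>
    (\<forall>s\<ge>0. \<forall>t\<ge>0. \<forall>x. T (s + t) x = T s (T t x)) \<and>
    (\<forall>x. ((\<lambda>t. T t x) \<longlongrightarrow> x) (at_right 0))"

text \<open>The infinitesimal generator, as a graph.\<close>

definition C0_generator :: "(real \<Rightarrow> 'a \<Rightarrow> 'a::complex_hilbert) \<Rightarrow> ('a \<times> 'a) set"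
  where "C0_generator T =
    {(x, y). ((\<lambda>h. (1 / h) *\<^sub>R (T h x - x)) \<longlongrightarrow> y) (at_right 0)}"

definition generates_C0_semigroup :: "'a::complex_hilbert set \<Rightarrow> ('a \<Rightarrow> 'a) \<Rightarrow> bool"
  where "generates_C0_semigroup D A \<longleftrightarrow>
    (\<exists>T. C0_semigroup T \<and> C0_generator T = op_graph D A)"

text \<open>A triple \<open>(G, L, K)\<close> of operators with common domain \<open>Z\<close>, the solution space.\<close>

definition internally_well_posed_node ::
    "'x::complex_hilbert set \<Rightarrow> ('x \<Rightarrow> 'u::complex_hilbert) \<Rightarrow> ('x \<Rightarrow> 'x) \<Rightarrow>
      ('x \<Rightarrow> 'y::complex_hilbert) \<Rightarrow> bool"
  where "internally_well_posed_node Z G L K \<longleftrightarrow>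
    linear_operator Z G \<and> linear_operator Z L \<and> linear_operator Z K \<and>
    closed_operator Z (\<lambda>z. (G z, L z, K z)) \<and>
    G ` Z = UNIV \<and>
    closure (op_kernel Z G) = UNIV \<and>
    generates_C0_semigroup (op_kernel Z G) L"

text \<open>The operator \<open>L\<close> restricted to \<open>ker G\<close>, as a graph.\<close>

definition semigroup_generator ::
    "'x::complex_hilbert set \<Rightarrow> ('x \<Rightarrow> 'u::complex_hilbert) \<Rightarrow> ('x \<Rightarrow> 'x) \<Rightarrow> ('x \<times> 'x) set"
  where "semigroup_generator Z G L = op_graph (op_kernel Z G) L"

definition strong_node ::
    "'x::complex_hilbert set \<Rightarrow> ('x \<Rightarrow> 'u::complex_hilbert) \<Rightarrow> ('x \<Rightarrow> 'x) \<Rightarrow>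
      ('x \<Rightarrow> 'y::complex_hilbert) \<Rightarrow> bool"
  where "strong_node Z G L K \<longleftrightarrow> internally_well_posed_node Z G L K \<and> closed_operator Z L"

definition solution_space_norm ::
    "('x::complex_hilbert \<Rightarrow> 'u::complex_hilbert) \<Rightarrow> ('x \<Rightarrow> 'x) \<Rightarrow>
      ('x \<Rightarrow> 'y::complex_hilbert) \<Rightarrow> 'x \<Rightarrow> real"
  where "solution_space_norm G L K z =
    sqrt ((norm z)\<^sup>2 + (norm (L z))\<^sup>2 + (norm (G z))\<^sup>2 + (norm (K z))\<^sup>2)"

definition continuous_into_solution_space ::
    "'x::complex_hilbert set \<Rightarrow> ('x \<Rightarrow> 'u::complex_hilbert) \<Rightarrow> ('x \<Rightarrow> 'x) \<Rightarrow>
      ('x \<Rightarrow> 'y::complex_hilbert) \<Rightarrow> (real \<Rightarrow> 'x) \<Rightarrow> bool"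
  where "continuous_into_solution_space Z G L K z \<longleftrightarrow>
    (\<forall>t\<ge>0. z t \<in> Z) \<and>
    (\<forall>t\<ge>0. ((\<lambda>s. solution_space_norm G L K (z s - z t)) \<longlongrightarrow> 0) (at t within {0..}))"

text \<open>Functions of class \<open>C\<^sup>n\<close> on the closed half-line (with one-sided derivatives at 0).\<close>

primrec Cn_halfline :: "nat \<Rightarrow> (real \<Rightarrow> 'a::real_normed_vector) \<Rightarrow> bool" where
  "Cn_halfline 0 f \<longleftrightarrow> continuous_on {0..} f"
| "Cn_halfline (Suc n) f \<longleftrightarrow>
    (\<exists>f'. (\<forall>t\<ge>0. (f has_vector_derivative f' t) (at t within {0..})) \<and> Cn_halfline n f')"

text \<open>
  Smooth solution \<open>z\<close> with input \<open>u\<close>; the initial value is \<open>z 0\<close>, which lies in \<open>Z\<close> and satisfies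
  \<open>G (z 0) = u 0\<close> by the conditions below. The output is \<open>\<lambda>t. K (z t)\<close>.
\<close>

definition smooth_solution ::
    "'x::complex_hilbert set \<Rightarrow> ('x \<Rightarrow> 'u::complex_hilbert) \<Rightarrow> ('x \<Rightarrow> 'x) \<Rightarrow>
      ('x \<Rightarrow> 'y::complex_hilbert) \<Rightarrow> (real \<Rightarrow> 'u) \<Rightarrow> (real \<Rightarrow> 'x) \<Rightarrow> bool"
  where "smooth_solution Z G L K u z \<longleftrightarrow>
    Cn_halfline 2 u \<and>
    Cn_halfline 1 z \<and>
    continuous_into_solution_space Z G L K z \<and>
    (\<forall>t\<ge>0. u t = G (z t) \<and> (z has_vector_derivative L (z t)) (at t within {0..}))"

definition scattering_passive_node ::
    "'x::complex_hilbert set \<Rightarrow> ('x \<Rightarrow> 'u::complex_hilbert) \<Rightarrow> ('x \<Rightarrow> 'x) \<Rightarrow>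
      ('x \<Rightarrow> 'y::complex_hilbert) \<Rightarrow> bool"
  where "scattering_passive_node Z G L K \<longleftrightarrow>
    internally_well_posed_node Z G L K \<and>
    (\<forall>u z. smooth_solution Z G L K u z \<longrightarrow>
      (\<forall>t\<ge>0. \<exists>d. ((\<lambda>s. (norm (z s))\<^sup>2) has_real_derivative d) (at t within {0..}) \<and>
        d + (norm (K (z t)))\<^sup>2 \<le> (norm (u t))\<^sup>2))"

end

theory Submission
  imports Defs
begin

text \<open>
  Along the solution that starts in a given \<open>z\<close> in the solution space and has constant input, the
  passivity inequality at time 0 reads \<open>2 Re \<langle>z, Lz\<rangle> + \<parallel>Kz\<parallel>\<^sup>2 \<le> \<parallel>Gz\<parallel>\<^sup>2\<close>. For the extended node and
  \<open>z\<close> in the kernel of \<open>Gt\<close> it bounds \<open>Kt z\<close> by \<open>z\<close>, \<open>G z\<close> and \<open>L z\<close>. Therefore dropping the output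
  component \<open>Kt\<close> preserves closedness, and a smooth solution of the restricted node is one of the
  extended node with input \<open>(u, 0)\<close>. That the solution with constant input is continuous into the
  solution space rests on the closed graph theorem, applied to the output operator on the domain of
  the semigroup generator. If \<open>L\<close> is closed, the closed graph theorem also bounds \<open>Gt\<close> by the graph
  norm of \<open>L\<close>, so the kernel of \<open>Gt\<close> is closed in that norm.
\<close>

text \<open>Completeness is part of the class, so the Banach space theorems below apply to Hilbert
  spaces and, through the product instance, to their direct sums.\<close>

instance complex_hilbert \<subseteq> banach ..

section \<open>The uniform boundedness and closed graph theorems\<close>

text \<open>
  Zabreiko's lemma. By Baire's theorem some sublevel set of \<open>p\<close> is dense in a ball around the
  origin; expanding a point of the ball into a series of elements of geometrically shrinking
  sublevel sets then bounds \<open>p\<close> on the ball itself.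
\<close>

lemma countably_subadditive_seminorm_bounded:
  fixes S :: "'a::banach set" and p :: "'a \<Rightarrow> real"
  assumes S: "subspace S" "closed S"
    and add: "\<And>x y. x \<in> S \<Longrightarrow> y \<in> S \<Longrightarrow> p (x + y) \<le> p x + p y"
    and scale: "\<And>c x. x \<in> S \<Longrightarrow> p (c *\<^sub>R x) = \<bar>c\<bar> * p x"
    and sums: "\<And>xs x. (\<And>n. xs n \<in> S) \<Longrightarrow> xs sums x \<Longrightarrow> summable (\<lambda>n. p (xs n)) \<Longrightarrow>
      p x \<le> (\<Sum>n. p (xs n))"
  shows "\<exists>C. \<forall>x\<in>S. p x \<le> C * norm x"
proof -
  have S0: "0 \<in> S" using S(1) by (rule subspace_0)
  have p0: "p 0 = 0" using scale[OF S0, of 0] by simp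
  have minus: "p (- x) = p x" if "x \<in> S" for x using scale[OF that, of "-1"] by simp
  \<comment> \<open>Subadditivity at \<open>x\<close> and \<open>- x\<close> gives 0 =
    \<open>p 0\<close> \<le> 2 \<open>p x\<close>.\<close>
  have nonneg: "0 \<le> p x" if "x \<in> S" for x
    using add[OF that subspace_neg[OF S(1) that]] minus[OF that] p0 by simp
  define V where "V n = {x \<in> S. p x \<le> real n}" for n
  have VS: "closure (V n) \<subseteq> S" for n
    using closure_minimal[of "V n" S] S(2) by (auto simp: V_def)
  have un: "\<Union> (range (\<lambda>n. closure (V n))) = S"
  proof
    show "S \<subseteq> \<Union> (range (\<lambda>n. closure (V n)))"
    proof
      fix x assume "x \<in> S"
      then have "x \<in> V (nat \<lceil>p x\<rceil>)" by (simp add: V_def real_nat_ceiling_ge)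
      then show "x \<in> \<Union> (range (\<lambda>n. closure (V n)))" using closure_subset by blast
    qed
  qed (use VS in auto)
  \<comment> \<open>Baire's theorem in the complete space \<open>S\<close>: closed sets without
    interior cannot have the union \<open>S\<close>, which is its own interior.\<close>
  have "\<exists>n. (top_of_set S) interior_of (closure (V n)) \<noteq> {}"
  proof (rule ccontr)
    assume "\<not> ?thesis"
    then have "(top_of_set S) interior_of \<Union> (range (\<lambda>n. closure (V n))) = {}"
      using VS
      by (intro Baire_category_alt disjI1 completely_metrizable_space_closedin
          completely_metrizable_space_euclidean) (auto simp: S(2) closed_subset)
    then show False using S0 un interior_of_topspace[of "top_of_set S"] by auto
  qed
  then obtain n U x0 where U: "openin (top_of_set S) U" "x0 \<in> U" "U \<subseteq> closure (V n)"
    by (auto simp: interior_of_def)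
  from U(1) obtain W where W: "open W" "U = S \<inter> W" by (auto simp: openin_open)
  with U(2) obtain r where r: "0 < r" "ball x0 r \<subseteq> W" by (auto elim: openE)
  have x0: "x0 \<in> S" using U(2) W by auto
  \<comment> \<open>A vector \<open>x\<close> is half the difference of \<open>x0 + x\<close> and
    \<open>x0 - x\<close>, so approximating both by elements of \<open>V n\<close> moves the ball
    from \<open>x0\<close> to the origin.\<close>
  have near: "\<exists>y\<in>S. p y \<le> real n \<and> dist y x < e" if x: "x \<in> S" "norm x < r" and e: "0 < e" for x e
  proof -
    have "x0 + x \<in> closure (V n)" "x0 - x \<in> closure (V n)"
      using x r W U(3) x0 S(1) by (auto simp: subset_iff dist_norm subspace_add subspace_diff)
    then obtain a b where a: "a \<in> V n" "dist a (x0 + x) < e" and b: "b \<in> V n" "dist b (x0 - x) < e"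
      using e unfolding closure_approachable by blast
    have ab: "a \<in> S" "b \<in> S" "p a \<le> n" "p b \<le> n" using a b by (auto simp: V_def)
    have "p ((1/2) *\<^sub>R (a + - b)) \<le> real n"
      using scale[of "a + - b" "1/2"] add[of a "- b"] minus[of b] ab S(1)
      by (simp add: subspace_diff subspace_neg)
    moreover have "dist ((1/2) *\<^sub>R (a + - b)) x < e"
    proof -
      have "(1/2) *\<^sub>R (a + - b) - x = (1/2) *\<^sub>R ((a - (x0 + x)) - (b - (x0 - x)))"
        by (simp add: algebra_simps flip: scaleR_2 scaleR_add_left)
      then have "dist ((1/2) *\<^sub>R (a + - b)) x = (1/2) * norm ((a - (x0 + x)) - (b - (x0 - x)))"
        by (simp add: dist_norm)
      also have "\<dots> \<le> (1/2) * (norm (a - (x0 + x)) + norm (b - (x0 - x)))"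
        by (intro mult_left_mono norm_triangle_ineq4) auto
      also have "\<dots> < e" using a(2) b(2) by (simp add: dist_norm)
      finally show ?thesis .
    qed
    ultimately show ?thesis
      using ab S(1) by (intro bexI[of _ "(1/2) *\<^sub>R (a + - b)"])
        (auto intro!: subspace_scale subspace_diff)
  qed
  \<comment> \<open>Rescaling a nonzero \<open>x\<close> to norm \<open>r / 2\<close>, approximating
    and scaling back multiplies the bound \<open>n\<close> by \<open>2 * norm x / r\<close>.\<close>
  define M where "M = 2 * real n / r"
  have M0: "0 \<le> M" using r by (simp add: M_def)
  have near': "\<exists>y\<in>S. p y \<le> M * norm x \<and> norm (x - y) \<le> e" if x: "x \<in> S" and e: "0 < e" for x e
  proof (cases "x = 0")
    case True
    then show ?thesis using e S0 p0 by (intro bexI[of _ 0]) auto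
  next
    case False
    define c where "c = r / (2 * norm x)"
    have c: "c > 0" using False r by (simp add: c_def)
    have "norm (c *\<^sub>R x) < r" using c False r by (simp add: c_def)
    then obtain y where y: "y \<in> S" "p y \<le> n" "dist y (c *\<^sub>R x) < c * e"
      using near[of "c *\<^sub>R x" "c * e"] x S(1) e c by (auto simp: subspace_scale)
    have "p ((1/c) *\<^sub>R y) \<le> M * norm x"
      using scale[OF y(1), of "1/c"] y(2) c r False
      by (simp add: M_def c_def divide_simps mult.commute)
    moreover have "x - (1/c) *\<^sub>R y = (1/c) *\<^sub>R (c *\<^sub>R x - y)" using c by (simp add: algebra_simps)
    then have "norm (x - (1/c) *\<^sub>R y) \<le> e"
      using y(3) c by (simp add: dist_norm norm_minus_commute divide_simps mult.commute)
    ultimately show ?thesis using y(1) S(1) by (intro bexI[of _ "(1/c) *\<^sub>R y"]) (auto simp: subspace_scale)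
  qed
  then obtain g where g: "\<And>x e. x \<in> S \<Longrightarrow> 0 < e \<Longrightarrow> g x e \<in> S \<and> p (g x e) \<le> M * norm x \<and> norm (x - g x e) \<le> e"
    by metis
  show ?thesis
  proof (intro exI ballI)
    fix x assume x: "x \<in> S"
    show "p x \<le> (2 * M) * norm x"
    proof (cases "x = 0")
      case True
      then show ?thesis by (simp add: p0)
    next
      case False
      \<comment> \<open>\<open>res k\<close> is what remains of \<open>x\<close> after
        \<open>k\<close> approximation steps. Its norm is at most \<open>norm x * (1/2) ^ k\<close>,
        so the removed terms \<open>xs k\<close> sum to \<open>x\<close> and their
        \<open>p\<close>-values are dominated by a geometric series with sum
        \<open>2 * M * norm x\<close>.\<close>
      define res where "res = rec_nat x (\<lambda>k y. y - g y (norm x * (1/2) ^ Suc k))"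
      have res_Suc: "res (Suc k) = res k - g (res k) (norm x * (1/2) ^ Suc k)" for k
        by (simp add: res_def)
      have resS: "res k \<in> S" for k
        by (induction k) (use x g False S(1) in \<open>auto simp: res_Suc subspace_diff\<close>, simp add: res_def)
      have res_le: "norm (res k) \<le> norm x * (1/2) ^ k" for k
      proof (cases k)
        case (Suc j)
        then show ?thesis using g[OF resS[of j], of "norm x * (1/2) ^ Suc j"] False
          by (simp add: res_Suc)
      qed (simp add: res_def)
      define xs where "xs k = g (res k) (norm x * (1/2) ^ Suc k)" for k
      have xsS: "xs k \<in> S" and pxs: "p (xs k) \<le> M * norm (res k)" for k
        using g[OF resS[of k], of "norm x * (1/2) ^ Suc k"] False by (auto simp: xs_def)
      have "(\<Sum>k<m. xs k) = x - res m" for m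
        by (induction m) (simp add: res_def, simp add: res_Suc xs_def)
      moreover have "res \<longlonglongrightarrow> 0"
      proof (rule Lim_null_comparison)
        show "\<forall>\<^sub>F k in sequentially. norm (res k) \<le> norm x * (1/2) ^ k" using res_le by simp
        show "(\<lambda>k. norm x * (1/2) ^ k) \<longlonglongrightarrow> 0"
          using tendsto_mult_right_zero[OF LIMSEQ_power_zero[of "1/2::real"]] by simp
      qed
      ultimately have "xs sums x"
        unfolding sums_def using tendsto_diff[OF tendsto_const, of res 0 sequentially x] by simp
      have gs: "(\<lambda>k. M * norm x * (1/2) ^ k) sums (M * norm x * 2)"
        using sums_mult[OF geometric_sums[of "1/2::real"], of "M * norm x"] by simp
      have le: "p (xs k) \<le> M * norm x * (1/2) ^ k" for k
        using order_trans[OF pxs mult_left_mono[OF res_le M0]] by (simp add: mult.assoc)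
      have sm: "summable (\<lambda>k. p (xs k))"
        by (rule summable_comparison_test'[OF sums_summable[OF gs]]) (use le nonneg xsS in auto)
      have "p x \<le> (\<Sum>k. p (xs k))" by (rule sums) fact+
      also have "\<dots> \<le> M * norm x * 2"
        using suminf_le[OF le sm sums_summable[OF gs]] sums_unique[OF gs] by simp
      finally show ?thesis by simp
    qed
  qed
qed

text \<open>The preceding lemma for the seminorm \<open>norm (f x)\<close>: if the norms of the
  images are summable, their series converges, and closedness of the graph identifies its sum as
  \<open>f x\<close>. The domain is a closed subspace so that it can later be the graph of another
  operator.\<close>

theorem closed_graph:
  fixes S :: "'a::banach set" and f :: "'a \<Rightarrow> 'b::banach"
  assumes S: "subspace S" "closed S"
    and add: "\<And>x y. x \<in> S \<Longrightarrow> y \<in> S \<Longrightarrow> f (x + y) = f x + f y"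
    and scale: "\<And>c x. x \<in> S \<Longrightarrow> f (c *\<^sub>R x) = c *\<^sub>R f x"
    and closed: "closed (op_graph S f)"
  shows "\<exists>C. \<forall>x\<in>S. norm (f x) \<le> C * norm x"
proof (rule countably_subadditive_seminorm_bounded[OF S])
  show "norm (f (x + y)) \<le> norm (f x) + norm (f y)" if "x \<in> S" "y \<in> S" for x y
    using add[OF that] norm_triangle_ineq by simp
  show "norm (f (c *\<^sub>R x)) = \<bar>c\<bar> * norm (f x)" if "x \<in> S" for c x
    using scale[OF that] by simp
next
  fix xs x assume xs: "\<And>n. xs n \<in> S" "xs sums x" and sm: "summable (\<lambda>n. norm (f (xs n)))"
  have part: "(\<Sum>k<n. xs k) \<in> S \<and> f (\<Sum>k<n. xs k) = (\<Sum>k<n. f (xs k))" for n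
  proof (induction n)
    case 0
    show ?case using scale[OF subspace_0[OF S(1)], of 0] subspace_0[OF S(1)] by simp
  qed (use add xs(1) S(1) in \<open>auto simp: subspace_add\<close>)
  have "(\<lambda>n. (\<Sum>k<n. xs k, f (\<Sum>k<n. xs k))) \<longlonglongrightarrow> (x, \<Sum>k. f (xs k))"
    using xs(2) summable_sums[OF summable_norm_cancel[OF sm]] part
    by (intro tendsto_Pair) (auto simp: sums_def)
  then have "(x, \<Sum>k. f (xs k)) \<in> op_graph S f"
    by (rule closed_sequentially[OF closed, rotated]) (use part in \<open>auto simp: op_graph_def\<close>)
  then show "norm (f x) \<le> (\<Sum>n. norm (f (xs n)))"
    using summable_norm[OF sm] by (auto simp: op_graph_def)
qed

text \<open>The same lemma for the supremum of \<open>norm (T n x)\<close> over \<open>n\<close>,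
  which is countably subadditive because each \<open>T n\<close> is continuous.\<close>

theorem uniform_boundedness:
  fixes T :: "nat \<Rightarrow> 'a::banach \<Rightarrow> 'b::real_normed_vector"
  assumes lin: "\<And>n. bounded_linear (T n)" and bdd: "\<And>x. bounded (range (\<lambda>n. T n x))"
  shows "\<exists>C. \<forall>n x. norm (T n x) \<le> C * norm x"
proof -
  define p where "p x = (SUP n. norm (T n x))" for x
  have bdd': "bdd_above (range (\<lambda>n. norm (T n x)))" for x
    using bdd[of x] by (auto simp: bounded_iff intro: bdd_aboveI2)
  have le: "norm (T n x) \<le> p x" for n x
    unfolding p_def by (rule cSUP_upper[OF _ bdd']) simp
  have p_le: "p x \<le> c" if "\<And>n. norm (T n x) \<le> c" for x c
    unfolding p_def by (rule cSUP_least) (use that in auto)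
  have scale_le: "p (c *\<^sub>R x) \<le> \<bar>c\<bar> * p x" for c x
    by (rule p_le) (simp add: linear_simps(5)[OF lin] mult_left_mono le)
  have "\<exists>C. \<forall>x\<in>UNIV. p x \<le> C * norm x"
  proof (rule countably_subadditive_seminorm_bounded)
    show "p (x + y) \<le> p x + p y" for x y
      by (rule p_le) (metis add_mono le linear_simps(1)[OF lin] norm_triangle_le)
    \<comment> \<open>For nonzero \<open>c\<close> the reverse inequality is \<open>scale_le\<close>
      for the factor \<open>1/c\<close> at \<open>c *\<^sub>R x\<close>.\<close>
    show "p (c *\<^sub>R x) = \<bar>c\<bar> * p x" for c x
    proof (cases "c = 0")
      case True
      then show ?thesis by (simp add: p_def linear_simps(3)[OF lin])
    next
      case False
      then show ?thesis using scale_le[of c x] scale_le[of "1/c" "c *\<^sub>R x"]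
        by (simp add: divide_simps mult.commute)
    qed
    fix xs x assume xs: "xs sums x" and sm: "summable (\<lambda>n. p (xs n))"
    show "p x \<le> (\<Sum>k. p (xs k))"
    proof (rule p_le)
      fix n
      have sm': "summable (\<lambda>k. norm (T n (xs k)))"
        by (rule summable_comparison_test'[OF sm]) (simp add: le)
      have "norm (\<Sum>k<m. T n (xs k)) \<le> (\<Sum>k. p (xs k))" for m
      proof -
        have "norm (\<Sum>k<m. T n (xs k)) \<le> (\<Sum>k<m. p (xs k))"
          by (rule order_trans[OF norm_sum sum_mono]) (rule le)
        also have "\<dots> \<le> (\<Sum>k. p (xs k))"
          by (rule sum_le_suminf[OF sm]) (auto intro: order_trans[OF norm_ge_zero le])
        finally show ?thesis .
      qed
      moreover have "(\<lambda>m. norm (\<Sum>k<m. T n (xs k))) \<longlonglongrightarrow> norm (T n x)"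
        using bounded_linear.sums[OF lin xs, of n] by (auto simp: sums_def intro: tendsto_norm)
      ultimately show "norm (T n x) \<le> (\<Sum>k. p (xs k))"
        by (intro LIMSEQ_le_const2) auto
    qed
  qed auto
  then show ?thesis using le by (meson UNIV_I order_trans)
qed

section \<open>Strongly continuous semigroups\<close>

text \<open>Turns derivatives on the half-line into the one-sided difference quotients that define
  \<open>C0_generator\<close>.\<close>

lemma has_vector_derivative_imp_right_quotient:
  fixes f :: "real \<Rightarrow> 'a::real_normed_vector"
  assumes "0 \<le> t" "(f has_vector_derivative d) (at t within {0..})"
  shows "((\<lambda>h. (1 / h) *\<^sub>R (f (t + h) - f t)) \<longlongrightarrow> d) (at_right 0)"
proof -
  have "(f has_vector_derivative d) (at t within {t<..})"
    using assms by (auto intro: has_vector_derivative_within_subset)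
  then have "((\<lambda>y. (1 / norm (y - t)) *\<^sub>R (f y - (f t + (y - t) *\<^sub>R d))) \<longlongrightarrow> 0) (at_right t)"
    by (simp add: has_vector_derivative_def has_derivative_within)
  then have "((\<lambda>h. (1 / norm h) *\<^sub>R (f (t + h) - (f t + h *\<^sub>R d))) \<longlongrightarrow> 0) (at_right 0)"
    by (subst (asm) filterlim_at_right_to_0) (simp add: add.commute)
  moreover have "\<forall>\<^sub>F h in at_right 0. (1 / norm h) *\<^sub>R (f (t + h) - (f t + h *\<^sub>R d)) =
      (1 / h) *\<^sub>R (f (t + h) - f t) - d"
    by (auto simp: eventually_at_filter scaleR_diff_right scaleR_add_right)
  ultimately have "((\<lambda>h. (1 / h) *\<^sub>R (f (t + h) - f t) - d) \<longlongrightarrow> 0) (at_right 0)"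
    by (rule Lim_transform_eventually)
  then show ?thesis by (simp add: LIM_zero_iff)
qed

locale C0_semigroup_on =
  fixes T :: "real \<Rightarrow> 'a \<Rightarrow> 'a::complex_hilbert"
  assumes C0: "C0_semigroup T"
begin

lemma bounded_linear_T: "0 \<le> t \<Longrightarrow> bounded_linear (T t)"
  and T_0 [simp]: "T 0 x = x"
  and T_add: "0 \<le> s \<Longrightarrow> 0 \<le> t \<Longrightarrow> T (s + t) x = T s (T t x)"
  and T_tendsto_0: "((\<lambda>t. T t x) \<longlongrightarrow> x) (at_right 0)"
  using C0 by (auto simp: C0_semigroup_def)

lemmas T_linear = linear_simps[OF bounded_linear_T]

lemma isCont_T_0: "continuous (at 0 within {0..}) (\<lambda>t. T t x)"
  using T_tendsto_0 by (simp add: continuous_within at_within_Ici_at_right)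

text \<open>Otherwise there are times \<open>t n\<close> tending to 0 at which \<open>T\<close>
  violates the bound \<open>n\<close>. Strong continuity at 0 makes every sequence
  \<open>T (t n) y\<close> bounded, which contradicts uniform boundedness.\<close>

lemma bounded_near_0: "\<exists>\<delta>>0. \<exists>M. \<forall>t\<in>{0..\<delta>}. \<forall>x. norm (T t x) \<le> M * norm x"
proof (rule ccontr)
  assume neg: "\<not> ?thesis"
  have "\<exists>t x. t \<in> {0..1 / real (Suc n)} \<and> norm (T t x) > real n * norm x" for n
  proof (rule ccontr)
    assume "\<not> ?thesis"
    then have "\<forall>t\<in>{0..1 / real (Suc n)}. \<forall>x. norm (T t x) \<le> real n * norm x"
      by (meson not_le)
    moreover have "0 < 1 / real (Suc n)" by simp
    ultimately show False using neg by blast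
  qed
  then obtain t x where t: "\<And>n. t n \<in> {0..1 / real (Suc n)}"
    and x: "\<And>n. norm (T (t n) (x n)) > real n * norm (x n)" by metis
  have "t \<longlonglongrightarrow> 0"
  proof (rule Lim_null_comparison)
    show "\<forall>\<^sub>F n in sequentially. norm (t n) \<le> 1 / real (Suc n)" using t by simp
    show "(\<lambda>n. 1 / real (Suc n)) \<longlonglongrightarrow> 0" by (rule LIMSEQ_Suc[OF lim_1_over_n])
  qed
  then have "(\<lambda>n. T (t n) y) \<longlonglongrightarrow> T 0 y" for y
    using t by (intro continuous_within_tendsto_compose'[OF isCont_T_0]) auto
  then have "bounded (range (\<lambda>n. T (t n) y))" for y
    by (rule convergent_imp_bounded)
  then obtain C where C: "\<And>n y. norm (T (t n) y) \<le> C * norm y"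
    using uniform_boundedness[of "\<lambda>n. T (t n)"] bounded_linear_T t by auto
  obtain n :: nat where "C \<le> real n" using real_arch_simple by blast
  then show False using C[of n "x n"] x[of n] mult_right_mono[of C "real n" "norm (x n)"] by simp
qed

text \<open>The interval is covered by finitely many steps of length \<open>\<delta>\<close>, each
  of which contributes a factor \<open>M\<close> by the semigroup law.\<close>

lemma locally_bounded:
  obtains M where "0 \<le> M" "\<And>s x. 0 \<le> s \<Longrightarrow> s \<le> t \<Longrightarrow> norm (T s x) \<le> M * norm x"
proof -
  obtain \<delta> M0 where \<delta>: "\<delta> > 0" "\<And>s x. s \<in> {0..\<delta>} \<Longrightarrow> norm (T s x) \<le> M0 * norm x"
    using bounded_near_0 by metis
  define M where "M = max M0 1"
  have M: "1 \<le> M" "norm (T s x) \<le> M * norm x" if "s \<in> {0..\<delta>}" for s x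
    using order_trans[OF \<delta>(2)[OF that] mult_right_mono[of M0 M "norm x"]] by (auto simp: M_def)
  have M1: "1 \<le> M" by (simp add: M_def)
  have step: "norm (T s x) \<le> M ^ k * norm x" if "s \<in> {0..real k * \<delta>}" for k s x
    using that
  proof (induction k arbitrary: s x)
    case 0
    then show ?case by simp
  next
    case (Suc k)
    define s' where "s' = min s (real k * \<delta>)"
    have s': "s' \<in> {0..real k * \<delta>}" "s - s' \<in> {0..\<delta>}"
      using Suc.prems \<delta>(1) by (auto simp: s'_def min_def algebra_simps)
    have "norm (T s x) = norm (T s' (T (s - s') x))"
      using T_add[of s' "s - s'" x] s' by simp
    also have "\<dots> \<le> M ^ k * norm (T (s - s') x)" by (rule Suc.IH[OF s'(1)])
    also have "\<dots> \<le> M ^ k * (M * norm x)"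
      using M(2)[OF s'(2)] M1 by (intro mult_left_mono) auto
    finally show ?case by (simp add: mult.assoc mult.left_commute)
  qed
  obtain k :: nat where "t / \<delta> \<le> real k" using real_arch_simple by blast
  then have "t \<le> real k * \<delta>" using \<delta>(1) by (simp add: divide_simps)
  then show thesis using M1 step[of _ k] by (intro that[of "M ^ k"]) auto
qed

text \<open>Factoring out \<open>T\<close> at the smaller of the two times reduces continuity from
  either side to right continuity at 0, up to the local bound of \<open>T\<close>.\<close>

lemma continuous_on_T: "continuous_on {0..} (\<lambda>t. T t x)"
  unfolding continuous_on_def
proof
  fix t :: real assume t: "t \<in> {0..}"
  obtain M where M: "0 \<le> M" "\<And>s x. 0 \<le> s \<Longrightarrow> s \<le> t + 1 \<Longrightarrow> norm (T s x) \<le> M * norm x"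
    using locally_bounded by metis
  have lim: "((\<lambda>s. \<bar>s - t\<bar>) \<longlongrightarrow> 0) (at t within {0..})"
    by (rule tendsto_eq_intros | simp)+
  have "((\<lambda>s. T \<bar>s - t\<bar> x) \<longlongrightarrow> T 0 x) (at t within {0..})"
    by (rule continuous_within_tendsto_compose'[OF isCont_T_0 _ lim]) simp
  then have "((\<lambda>s. T \<bar>s - t\<bar> x - x) \<longlongrightarrow> 0) (at t within {0..})"
    by (simp add: LIM_zero)
  then have null: "((\<lambda>s. M * norm (T \<bar>s - t\<bar> x - x)) \<longlongrightarrow> 0) (at t within {0..})"
    by (intro tendsto_mult_right_zero tendsto_norm_zero)
  have le: "norm (T s x - T t x) \<le> M * norm (T \<bar>s - t\<bar> x - x)" if s: "0 \<le> s" "s \<le> t + 1" for s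
  proof (cases "s \<le> t")
    case True
    then have "T t x - T s x = T s (T \<bar>s - t\<bar> x - x)"
      using T_add[of s "t - s" x] s by (simp add: T_linear)
    then show ?thesis using M(2)[OF s, of "T \<bar>s - t\<bar> x - x"] by (metis norm_minus_commute)
  next
    case False
    then have "T s x - T t x = T t (T \<bar>s - t\<bar> x - x)"
      using T_add[of t "s - t" x] t by (simp add: T_linear)
    then show ?thesis using M(2)[of t "T \<bar>s - t\<bar> x - x"] t by simp
  qed
  have "\<forall>\<^sub>F s in at t within {0..}. s \<in> {0..} \<and> s < t + 1"
    by (auto simp: eventually_at intro!: exI[of _ 1] simp: dist_real_def)
  then have "\<forall>\<^sub>F s in at t within {0..}. norm (T s x - T t x) \<le> M * norm (T \<bar>s - t\<bar> x - x)"
    by (rule eventually_mono) (use le in auto)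
  then have "((\<lambda>s. T s x - T t x) \<longlongrightarrow> 0) (at t within {0..})"
    using null by (rule Lim_null_comparison)
  then show "((\<lambda>t. T t x) \<longlongrightarrow> T t x) (at t within {0..})"
    by (simp add: LIM_zero_iff)
qed

lemma continuous_on_T_Icc: "0 \<le> a \<Longrightarrow> continuous_on {a..b} (\<lambda>t. T t x)"
  by (rule continuous_on_subset[OF continuous_on_T]) auto

section \<open>The integrated semigroup and its relation to the generator\<close>

definition orbit_integral :: "real \<Rightarrow> 'a \<Rightarrow> 'a"
  where "orbit_integral t x = integral {0..t} (\<lambda>s. T s x)"

lemma orbit_integral_0 [simp]: "orbit_integral 0 x = 0"
  by (simp add: orbit_integral_def)

lemma has_vector_derivative_orbit_integral:
  assumes "0 \<le> t"
  shows "((\<lambda>t. orbit_integral t x) has_vector_derivative T t x) (at t within {0..})"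
proof -
  \<comment> \<open>Passing to a compact interval that is a neighbourhood of \<open>t\<close> in the
    half-line makes the fundamental theorem of calculus applicable.\<close>
  have "at t within {0..t+1} = at t within {0..}"
    by (rule at_within_nhd[of t "{..<t+1}"]) auto
  then show ?thesis
    using integral_has_vector_derivative[OF continuous_on_T_Icc[of 0 "t+1" x], of t] assms
    by (simp add: orbit_integral_def)
qed

text \<open>As a bounded operator, \<open>T h\<close> passes under the integral, where it shifts the
  range of integration to \<open>{h..t+h}\<close>.\<close>

lemma T_orbit_integral:
  assumes "0 \<le> t" "0 \<le> h"
  shows "T h (orbit_integral t x) = orbit_integral (t + h) x - orbit_integral h x"
proof -
  have int: "(\<lambda>s. T s x) integrable_on {a..b}" if "0 \<le> a" for a b
    using continuous_on_T_Icc[OF that] by (rule integrable_continuous_real)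
  have "((\<lambda>s. T (s + h) x) has_integral integral {h..t+h} (\<lambda>s. T s x)) {0..t}"
    using has_integral_affinity[OF integrable_integral[OF int[OF assms(2), of "t+h", folded cbox_interval]], of 1 h]
    by (simp add: image_add_atLeastAtMost' flip: add_uminus_conv_diff)
  moreover have "((\<lambda>s. T h (T s x)) has_integral T h (orbit_integral t x)) {0..t}"
    using has_integral_linear[OF integrable_integral[OF int[of 0 t]] bounded_linear_T[OF assms(2)]]
    by (simp add: o_def orbit_integral_def)
  then have "((\<lambda>s. T (s + h) x) has_integral T h (orbit_integral t x)) {0..t}"
    by (rule has_integral_eq[rotated]) (use T_add[OF assms(2)] in \<open>simp add: add.commute\<close>)
  ultimately have "T h (orbit_integral t x) = integral {h..t+h} (\<lambda>s. T s x)"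
    by (rule has_integral_unique[rotated])
  moreover have "orbit_integral h x + integral {h..t+h} (\<lambda>s. T s x) = orbit_integral (t + h) x"
    unfolding orbit_integral_def using assms int by (intro Henstock_Kurzweil_Integration.integral_combine) auto
  ultimately show ?thesis by (simp add: algebra_simps)
qed

text \<open>The difference quotient of the semigroup at an orbit integral is the difference of two
  quotients of the integrated semigroup, taken at \<open>t\<close> and at 0, which tend to
  \<open>T t x\<close> and \<open>x\<close>.\<close>

lemma orbit_integral_in_generator:
  assumes t: "0 \<le> t"
  shows "(orbit_integral t x, T t x - x) \<in> C0_generator T"
proof -
  have "((\<lambda>h. (1 / h) *\<^sub>R (orbit_integral (t + h) x - orbit_integral t x) -
      (1 / h) *\<^sub>R (orbit_integral (0 + h) x - orbit_integral 0 x)) \<longlongrightarrow> T t x - T 0 x) (at_right 0)"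
    using t by (intro tendsto_diff has_vector_derivative_imp_right_quotient
        has_vector_derivative_orbit_integral) auto
  moreover have "\<forall>\<^sub>F h in at_right 0. (1 / h) *\<^sub>R (orbit_integral (t + h) x - orbit_integral t x) -
      (1 / h) *\<^sub>R (orbit_integral (0 + h) x - orbit_integral 0 x) =
      (1 / h) *\<^sub>R (T h (orbit_integral t x) - orbit_integral t x)"
    using t by (auto simp: eventually_at_filter T_orbit_integral algebra_simps)
  ultimately show ?thesis
    unfolding C0_generator_def by (auto intro: Lim_transform_eventually)
qed

lemma norm_orbit_integral_le:
  assumes "0 \<le> t" "\<And>s. 0 \<le> s \<Longrightarrow> s \<le> t \<Longrightarrow> norm (T s x) \<le> B"
  shows "norm (orbit_integral t x) \<le> B * t"
  using integral_bound[OF assms(1) continuous_on_T_Icc[of 0 t x], of B] assms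
  by (simp add: orbit_integral_def)

lemma bounded_linear_orbit_integral:
  assumes "0 \<le> t"
  shows "bounded_linear (orbit_integral t)"
proof -
  have int: "(\<lambda>s. T s x) integrable_on {0..t}" for x
    using continuous_on_T_Icc[of 0 t x] by (simp add: integrable_continuous_real)
  obtain M where M: "0 \<le> M" "\<And>s x. 0 \<le> s \<Longrightarrow> s \<le> t \<Longrightarrow> norm (T s x) \<le> M * norm x"
    using locally_bounded by metis
  show ?thesis
  proof (rule bounded_linear_intro)
    show "orbit_integral t (x + y) = orbit_integral t x + orbit_integral t y" for x y
      unfolding orbit_integral_def integral_add[OF int int, symmetric]
      by (rule integral_cong) (simp add: T_linear)
    show "orbit_integral t (r *\<^sub>R x) = r *\<^sub>R orbit_integral t x" for r x
      unfolding orbit_integral_def integral_cmul[symmetric]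
      by (rule integral_cong) (simp add: T_linear)
    show "norm (orbit_integral t x) \<le> norm x * (M * t)" for x
      using norm_orbit_integral_le[OF assms M(2)] by (simp add: ac_simps)
  qed
qed

text \<open>
  Computing the generator on \<open>\<integral>\<^sub>0\<^sup>t T(s)x ds\<close> once inside and once outside the integral.
\<close>

lemma generator_imp_orbit_integral_eq:
  assumes xy: "(x, y) \<in> C0_generator T" and t: "0 \<le> t"
  shows "T t x - x = orbit_integral t y"
proof (rule tendsto_unique)
  show "((\<lambda>h. (1 / h) *\<^sub>R (T h (orbit_integral t x) - orbit_integral t x)) \<longlongrightarrow> T t x - x) (at_right 0)"
    using orbit_integral_in_generator[OF t, of x] by (simp add: C0_generator_def)
  have "((\<lambda>h. orbit_integral t ((1 / h) *\<^sub>R (T h x - x))) \<longlongrightarrow> orbit_integral t y) (at_right 0)"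
    using xy by (intro bounded_linear.tendsto[OF bounded_linear_orbit_integral[OF t]]) (simp add: C0_generator_def)
  moreover have "T h (orbit_integral t x) = orbit_integral t (T h x)" if h: "0 \<le> h" for h
  proof -
    have "orbit_integral t (T h x) = integral {0..t} (\<lambda>s. T h (T s x))"
      unfolding orbit_integral_def
      by (rule integral_cong) (use T_add[OF h] T_add[OF _ h] in \<open>simp add: add.commute flip: T_add\<close>)
    also have "\<dots> = T h (orbit_integral t x)"
      unfolding orbit_integral_def
      using integral_linear[OF integrable_continuous_real[OF continuous_on_T_Icc[of 0 t x]] bounded_linear_T[OF h]]
      by (simp add: o_def)
    finally show ?thesis by simp
  qed
  then have "\<forall>\<^sub>F h in at_right 0. orbit_integral t ((1 / h) *\<^sub>R (T h x - x)) =
      (1 / h) *\<^sub>R (T h (orbit_integral t x) - orbit_integral t x)"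
    by (auto simp: eventually_at_filter linear_simps[OF bounded_linear_orbit_integral[OF t]])
  ultimately show "((\<lambda>h. (1 / h) *\<^sub>R (T h (orbit_integral t x) - orbit_integral t x)) \<longlongrightarrow>
      orbit_integral t y) (at_right 0)"
    by (rule Lim_transform_eventually)
qed simp

text \<open>The defining derivative does not pass to limits directly, but the integrated identity
  \<open>T t x - x = orbit_integral t y\<close> does. Dividing it by \<open>t\<close> and letting
  \<open>t\<close> tend to 0 recovers the derivative.\<close>

lemma closed_generator: "closed (C0_generator T)"
  unfolding closed_sequential_limits
proof (intro allI impI, elim conjE)
  fix p :: "nat \<Rightarrow> 'a \<times> 'a" and l
  assume p: "\<forall>n. p n \<in> C0_generator T" and l: "p \<longlonglongrightarrow> l"
  obtain x y where xy: "l = (x, y)" by (cases l)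
  have lim: "(\<lambda>n. fst (p n)) \<longlonglongrightarrow> x" "(\<lambda>n. snd (p n)) \<longlonglongrightarrow> y"
    using tendsto_fst[OF l] tendsto_snd[OF l] by (auto simp: xy)
  have eq: "T t x - x = orbit_integral t y" if t: "0 \<le> t" for t
  proof (rule LIMSEQ_unique)
    show "(\<lambda>n. T t (fst (p n)) - fst (p n)) \<longlonglongrightarrow> T t x - x"
      by (intro tendsto_diff bounded_linear.tendsto[OF bounded_linear_T[OF t]] lim)
    have "(\<lambda>n. orbit_integral t (snd (p n))) \<longlonglongrightarrow> orbit_integral t y"
      by (intro bounded_linear.tendsto[OF bounded_linear_orbit_integral[OF t]] lim)
    then show "(\<lambda>n. T t (fst (p n)) - fst (p n)) \<longlonglongrightarrow> orbit_integral t y"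
      using generator_imp_orbit_integral_eq[OF _ t, of "fst (p n)" "snd (p n)" for n] p by simp
  qed
  have "((\<lambda>h. (1 / h) *\<^sub>R (orbit_integral (0 + h) y - orbit_integral 0 y)) \<longlongrightarrow> T 0 y) (at_right 0)"
    by (intro has_vector_derivative_imp_right_quotient has_vector_derivative_orbit_integral) auto
  then have "((\<lambda>h. (1 / h) *\<^sub>R (T h x - x)) \<longlongrightarrow> y) (at_right 0)"
    unfolding T_0 by (rule Lim_transform_eventually) (auto simp: eventually_at_filter eq)
  then show "l \<in> C0_generator T" by (simp add: C0_generator_def xy)
qed

end

section \<open>Boundary nodes\<close>

text \<open>Passes from complex to real linearity, the setting of the closed graph theorem and of
  the subspace rules used below.\<close>

lemma linear_operator_real:
  assumes "linear_operator D A"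
  shows "subspace D"
    and "x \<in> D \<Longrightarrow> y \<in> D \<Longrightarrow> A (x + y) = A x + A y"
    and "x \<in> D \<Longrightarrow> A (r *\<^sub>R x) = r *\<^sub>R A x"
    and "x \<in> D \<Longrightarrow> y \<in> D \<Longrightarrow> A (x - y) = A x - A y"
    and "A 0 = 0"
proof -
  have D: "complex_vector.subspace D" and add: "\<And>x y. x \<in> D \<Longrightarrow> y \<in> D \<Longrightarrow> A (x + y) = A x + A y"
    and scale: "\<And>c x. x \<in> D \<Longrightarrow> A (c *\<^sub>C x) = c *\<^sub>C A x"
    using assms by (auto simp: linear_operator_def)
  show sub: "subspace D"
    using D by (auto simp: subspace_def complex_vector.subspace_def scaleR_scaleC)
  show scaleR: "A (r *\<^sub>R x) = r *\<^sub>R A x" if "x \<in> D" for r x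
    using scale[OF that] by (simp add: scaleR_scaleC)
  show "A (x + y) = A x + A y" if "x \<in> D" "y \<in> D"
    using add that by blast
  show "A (x - y) = A x - A y" if "x \<in> D" "y \<in> D"
    using add[OF that(1), of "- y"] scaleR[OF that(2), of "-1"] subspace_neg[OF sub that(2)] by simp
  show "A 0 = 0"
    using scaleR[OF subspace_0[OF sub], of 0] by simp
qed

lemma linear_operator_Pair:
  "linear_operator D (\<lambda>z. (A z, B z)) \<longleftrightarrow> linear_operator D A \<and> linear_operator D B"
  by (auto simp: linear_operator_def scaleC_prod_def)

lemma linear_operator_subset:
  "linear_operator D A \<Longrightarrow> complex_vector.subspace E \<Longrightarrow> E \<subseteq> D \<Longrightarrow> linear_operator E A"
  unfolding linear_operator_def by blast

lemma linear_operator_kernel: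
  assumes "linear_operator D A"
  shows "complex_vector.subspace (op_kernel D A)"
  using assms linear_operator_real(5)[OF assms]
  by (auto simp: linear_operator_def op_kernel_def complex_vector.subspace_def)

text \<open>The closed graph theorem on the graph of \<open>A\<close>, a Banach space in the graph
  norm, for the map sending \<open>(z, A z)\<close> to \<open>F z\<close>. The graph of this map is
  the joint graph of \<open>A\<close> and \<open>F\<close> up to rebracketing.\<close>

lemma relatively_bounded:
  assumes A: "linear_operator D A" and F: "linear_operator D F"
    and clA: "closed (op_graph D A)" and clAF: "closed (op_graph D (\<lambda>z. (A z, F z)))"
  shows "\<exists>C. \<forall>z\<in>D. norm (F z) \<le> C * norm (z, A z)"
proof -
  have sub: "subspace D" by (rule linear_operator_real(1)[OF A])
  have "\<exists>C. \<forall>p\<in>op_graph D A. norm (F (fst p)) \<le> C * norm p"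
  proof (rule closed_graph[OF _ clA])
    show "subspace (op_graph D A)"
      unfolding subspace_def
    proof (intro conjI ballI allI)
      show "0 \<in> op_graph D A"
        using subspace_0[OF sub] linear_operator_real(5)[OF A]
        by (force simp: op_graph_def image_iff zero_prod_def)
      show "x + y \<in> op_graph D A" if "x \<in> op_graph D A" "y \<in> op_graph D A" for x y
        using that subspace_add[OF sub] linear_operator_real(2)[OF A]
        by (force simp: op_graph_def)
      show "c *\<^sub>R x \<in> op_graph D A" if "x \<in> op_graph D A" for c x
        using that subspace_scale[OF sub] linear_operator_real(3)[OF A]
        by (force simp: op_graph_def)
    qed
    have "op_graph (op_graph D A) (\<lambda>p. F (fst p)) =
        (\<lambda>p. (fst (fst p), snd (fst p), snd p)) -` op_graph D (\<lambda>z. (A z, F z))"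
      by (force simp: op_graph_def)
    then show "closed (op_graph (op_graph D A) (\<lambda>p. F (fst p)))"
      by (auto intro!: closed_vimage[OF clAF] continuous_intros)
  qed (auto simp: op_graph_def linear_operator_real(2,3)[OF F])
  then show ?thesis by (auto simp: op_graph_def)
qed

text \<open>The norm of the solution space is the product norm of the nested pair
  \<open>(((z, L z), G z), K z)\<close>, so convergence is componentwise.\<close>

lemma solution_space_norm_tendsto_0_iff:
  "((\<lambda>s. solution_space_norm G L K (f s)) \<longlongrightarrow> 0) F \<longleftrightarrow>
    (f \<longlongrightarrow> 0) F \<and> ((\<lambda>s. L (f s)) \<longlongrightarrow> 0) F \<and> ((\<lambda>s. G (f s)) \<longlongrightarrow> 0) F \<and> ((\<lambda>s. K (f s)) \<longlongrightarrow> 0) F"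
proof -
  have eq: "solution_space_norm G L K z = norm (((z, L z), G z), K z)" for z
    by (simp add: solution_space_norm_def norm_Pair)
  have "((\<lambda>s. (((f s, L (f s)), G (f s)), K (f s))) \<longlongrightarrow> 0) F \<longleftrightarrow>
    (f \<longlongrightarrow> 0) F \<and> ((\<lambda>s. L (f s)) \<longlongrightarrow> 0) F \<and> ((\<lambda>s. G (f s)) \<longlongrightarrow> 0) F \<and> ((\<lambda>s. K (f s)) \<longlongrightarrow> 0) F"
    (is "?l \<longleftrightarrow> ?r")
  proof
    assume l: ?l
    show ?r
      using tendsto_fst[OF tendsto_fst[OF tendsto_fst[OF l]]]
        tendsto_snd[OF tendsto_fst[OF tendsto_fst[OF l]]] tendsto_snd[OF tendsto_fst[OF l]]
        tendsto_snd[OF l] by simp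
  next
    assume ?r
    then show ?l unfolding zero_prod_def by (intro tendsto_Pair) auto
  qed
  then show ?thesis by (simp add: eq tendsto_norm_zero_iff)
qed

text \<open>
  Hold the input constant: then \<open>z - z\<^sub>0\<close> solves an inhomogeneous equation with zero boundary
  value and constant inhomogeneity \<open>L z\<^sub>0\<close>, hence is an orbit integral.
\<close>

lemma smooth_solution_exists:
  assumes node: "internally_well_posed_node Z G L K" and z0: "z0 \<in> Z"
  shows "\<exists>z. smooth_solution Z G L K (\<lambda>_. G z0) z \<and> z 0 = z0"
proof -
  have G: "linear_operator Z G" and L: "linear_operator Z L" and K: "linear_operator Z K"
    and cl: "closed (op_graph Z (\<lambda>z. (G z, L z, K z)))"
    and gen: "generates_C0_semigroup (op_kernel Z G) L"
    using node by (auto simp: internally_well_posed_node_def closed_operator_def)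
  obtain T where T: "C0_semigroup T" and TL: "C0_generator T = op_graph (op_kernel Z G) L"
    using gen by (auto simp: generates_C0_semigroup_def)
  interpret C0_semigroup_on T by standard (rule T)
  let ?N = "op_kernel Z G"
  have N: "?N \<subseteq> Z" by (auto simp: op_kernel_def)
  note subN = linear_operator_kernel[OF G]
  note LN = linear_operator_subset[OF L subN N] and KN = linear_operator_subset[OF K subN N]
  \<comment> \<open>The part of the closed node graph with boundary component 0 is the graph of
    \<open>(L, K)\<close> on the kernel of \<open>G\<close>.\<close>
  have clLK: "closed (op_graph ?N (\<lambda>z. (L z, K z)))"
  proof -
    have "op_graph ?N (\<lambda>z. (L z, K z)) =
        (\<lambda>p. (fst p, 0, fst (snd p), snd (snd p))) -` op_graph Z (\<lambda>z. (G z, L z, K z))"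
      by (force simp: op_graph_def op_kernel_def)
    then show ?thesis
      by (auto intro!: closed_vimage[OF cl] continuous_intros)
  qed
  \<comment> \<open>On the kernel, \<open>L\<close> is a closed operator because it generates a
    semigroup, so the output is controlled by its graph norm.\<close>
  obtain C where C: "\<And>w. w \<in> ?N \<Longrightarrow> norm (K w) \<le> C * norm (w, L w)"
    using relatively_bounded[OF LN KN _ clLK] closed_generator TL by auto
  define w where "w t = orbit_integral t (L z0)" for t
  define z where "z t = z0 + w t" for t
  have wN: "w t \<in> ?N" and Lw: "L (w t) = T t (L z0) - L z0" if "0 \<le> t" for t
    using orbit_integral_in_generator[OF that, of "L z0"] TL by (auto simp: op_graph_def w_def)
  have wZ: "w t \<in> Z" if "0 \<le> t" for t using wN[OF that] N by auto
  have zZ: "z t \<in> Z" and Gz: "G (z t) = G z0" and Lz: "L (z t) = T t (L z0)" if "0 \<le> t" for t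
    using linear_operator_real(1,2)[OF G] linear_operator_real(2)[OF L] z0 wZ[OF that] wN[OF that] Lw[OF that]
    by (auto simp: z_def subspace_add op_kernel_def)
  have deriv: "(z has_vector_derivative T t (L z0)) (at t within {0..})" if "0 \<le> t" for t
    using has_vector_derivative_add[OF has_vector_derivative_const has_vector_derivative_orbit_integral[OF that]]
    unfolding z_def w_def by simp
  have "continuous_into_solution_space Z G L K z"
    unfolding continuous_into_solution_space_def solution_space_norm_tendsto_0_iff
  proof (intro conjI allI impI)
    fix t :: real assume t: "0 \<le> t"
    let ?F = "at t within {0..}"
    have ev: "\<forall>\<^sub>F s in ?F. 0 \<le> s" by (auto simp: eventually_at_filter)
    have "(z \<longlongrightarrow> z t) ?F"
      using has_vector_derivative_continuous[OF deriv[OF t]] by (simp add: continuous_within)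
    then show dz: "((\<lambda>s. z s - z t) \<longlongrightarrow> 0) ?F" by (simp add: LIM_zero)
    have "((\<lambda>s. T s (L z0)) \<longlongrightarrow> T t (L z0)) ?F"
      using continuous_on_T t by (auto simp: continuous_on_def)
    then have "((\<lambda>s. T s (L z0) - T t (L z0)) \<longlongrightarrow> 0) ?F" by (simp add: LIM_zero)
    then show dLz: "((\<lambda>s. L (z s - z t)) \<longlongrightarrow> 0) ?F"
      by (rule Lim_transform_eventually)
        (rule eventually_mono[OF ev], use Lz zZ t linear_operator_real(4)[OF L] in simp)
    show "((\<lambda>s. G (z s - z t)) \<longlongrightarrow> 0) ?F"
      by (rule tendsto_eventually)
        (rule eventually_mono[OF ev], use Gz zZ t linear_operator_real(4)[OF G] in simp)
    \<comment> \<open>Both states have boundary value \<open>G z0\<close>, so their difference lies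
      in the kernel of \<open>G\<close>, where the bound \<open>C\<close> is available.\<close>
    show "((\<lambda>s. K (z s - z t)) \<longlongrightarrow> 0) ?F"
    proof (rule Lim_null_comparison)
      show "\<forall>\<^sub>F s in ?F. norm (K (z s - z t)) \<le> C * norm (z s - z t, L (z s - z t))"
        by (rule eventually_mono[OF ev], rule C)
          (use Gz zZ t linear_operator_real(1,4)[OF G] in \<open>simp add: op_kernel_def subspace_diff\<close>)
      have "((\<lambda>s. (z s - z t, L (z s - z t))) \<longlongrightarrow> 0) ?F"
        unfolding zero_prod_def by (intro tendsto_Pair dz dLz)
      then show "((\<lambda>s. C * norm (z s - z t, L (z s - z t))) \<longlongrightarrow> 0) ?F"
        by (intro tendsto_mult_right_zero tendsto_norm_zero)
    qed
  qed (rule zZ)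
  moreover have "Cn_halfline 2 (\<lambda>_. G z0)"
    by (auto simp: numeral_2_eq_2 intro!: exI[of _ "\<lambda>_. 0"])
  moreover have "Cn_halfline 1 z"
    using deriv continuous_on_T by (auto intro!: exI[of _ "\<lambda>t. T t (L z0)"])
  ultimately have "smooth_solution Z G L K (\<lambda>_. G z0) z"
    unfolding smooth_solution_def using Gz Lz deriv by auto
  moreover have "z 0 = z0" by (simp add: z_def w_def)
  ultimately show ?thesis by blast
qed

section \<open>The passivity inequality for a single state\<close>

lemma has_real_derivative_norm_squared:
  assumes "(z has_vector_derivative v) (at t within S)"
  shows "((\<lambda>s. (norm (z s))\<^sup>2) has_real_derivative 2 * (z t \<bullet> v)) (at t within S)"
proof -
  have "((\<lambda>s. z s \<bullet> z s) has_derivative (\<lambda>h. z t \<bullet> (h *\<^sub>R v) + (h *\<^sub>R v) \<bullet> z t)) (at t within S)"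
    using assms unfolding has_vector_derivative_def by (intro has_derivative_inner)
  moreover have "(\<lambda>h. z t \<bullet> (h *\<^sub>R v) + (h *\<^sub>R v) \<bullet> z t) = (*) (2 * (z t \<bullet> v))"
    by (auto simp: inner_commute)
  ultimately show ?thesis
    by (simp add: has_field_derivative_def power2_norm_eq_inner)
qed

lemma scattering_passive_node_dissipative:
  assumes node: "scattering_passive_node Z G L K" and z0: "z0 \<in> Z"
  shows "2 * (z0 \<bullet> L z0) + (norm (K z0))\<^sup>2 \<le> (norm (G z0))\<^sup>2"
proof -
  have wp: "internally_well_posed_node Z G L K"
    and pass: "\<And>u z. smooth_solution Z G L K u z \<Longrightarrow> \<forall>t\<ge>0.
      \<exists>d. ((\<lambda>s. (norm (z s))\<^sup>2) has_real_derivative d) (at t within {0..}) \<and>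
        d + (norm (K (z t)))\<^sup>2 \<le> (norm (u t))\<^sup>2"
    using node unfolding scattering_passive_node_def by blast+
  obtain z where z: "smooth_solution Z G L K (\<lambda>_. G z0) z" "z 0 = z0"
    using smooth_solution_exists[OF wp z0] by blast
  obtain d where d: "((\<lambda>s. (norm (z s))\<^sup>2) has_real_derivative d) (at 0 within {0..})"
    "d + (norm (K z0))\<^sup>2 \<le> (norm (G z0))\<^sup>2"
    using pass[OF z(1)] z(2) by force
  have "(z has_vector_derivative L z0) (at 0 within {0..})"
    using z by (auto simp: smooth_solution_def)
  then have "((\<lambda>s. (norm (z s))\<^sup>2) has_real_derivative 2 * (z0 \<bullet> L z0)) (at 0 within {0..})"
    using has_real_derivative_norm_squared[of z "L z0" 0 "{0..}"] z(2) by simp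
  \<comment> \<open>The one-sided derivative is unique since 0 is a limit point of the
    half-line.\<close>
  with d(1) have "d = 2 * (z0 \<bullet> L z0)"
    by (intro vector_derivative_unique_within[of 0 "{0..}"])
      (auto simp: at_within_Ici_at_right simp flip: has_real_derivative_iff_has_vector_derivative)
  with d(2) show ?thesis by simp
qed

section \<open>Restriction of a passive node to the kernel of \<open>Gt\<close>\<close>

theorem theorem3p1:
  fixes Zt Z :: "'x::complex_hilbert set"
    and G :: "'x \<Rightarrow> 'u::complex_hilbert"
    and Gt :: "'x \<Rightarrow> 'ut::complex_hilbert"
    and L :: "'x \<Rightarrow> 'x"
    and K :: "'x \<Rightarrow> 'y::complex_hilbert"
    and Kt :: "'x \<Rightarrow> 'yt::complex_hilbert"
  assumes node: "scattering_passive_node Zt (\<lambda>z. (G z, Gt z)) L (\<lambda>z. (K z, Kt z))"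
    and Z: "Z = op_kernel Zt Gt"
  shows "scattering_passive_node Z G L K \<and>
    semigroup_generator Zt (\<lambda>z. (G z, Gt z)) L = semigroup_generator Z G L \<and>
    semigroup_generator Z G L = op_graph (op_kernel Zt G \<inter> op_kernel Zt Gt) L \<and>
    (strong_node Zt (\<lambda>z. (G z, Gt z)) L (\<lambda>z. (K z, Kt z)) \<longrightarrow> strong_node Z G L K)"
proof -
  let ?G = "\<lambda>z. (G z, Gt z)" and ?K = "\<lambda>z. (K z, Kt z)"
  have wp: "internally_well_posed_node Zt ?G L ?K"
    and pass: "\<And>u z. smooth_solution Zt ?G L ?K u z \<Longrightarrow> \<forall>t\<ge>0.
      \<exists>d. ((\<lambda>s. (norm (z s))\<^sup>2) has_real_derivative d) (at t within {0..}) \<and>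
        d + (norm (?K (z t)))\<^sup>2 \<le> (norm (u t))\<^sup>2"
    using node unfolding scattering_passive_node_def by blast+
  have G: "linear_operator Zt G" and Gt: "linear_operator Zt Gt" and L: "linear_operator Zt L"
    and K: "linear_operator Zt K" and Kt: "linear_operator Zt Kt"
    and cl: "closed (op_graph Zt (\<lambda>z. (?G z, L z, ?K z)))"
    and surj: "?G ` Zt = UNIV"
    and dense: "closure (op_kernel Zt ?G) = UNIV"
    and gen: "generates_C0_semigroup (op_kernel Zt ?G) L"
    using wp by (auto simp: internally_well_posed_node_def closed_operator_def linear_operator_Pair)
  have ZZt: "Z \<subseteq> Zt" and Z0: "\<And>z. z \<in> Z \<Longrightarrow> Gt z = 0" by (auto simp: Z op_kernel_def)
  have subZ: "complex_vector.subspace Z" unfolding Z by (rule linear_operator_kernel[OF Gt])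
  note lin = G[THEN linear_operator_subset, OF subZ ZZt] L[THEN linear_operator_subset, OF subZ ZZt]
    K[THEN linear_operator_subset, OF subZ ZZt] Kt[THEN linear_operator_subset, OF subZ ZZt]
  \<comment> \<open>Restriction does not change the generator domain, so density and generation
    carry over from the extended node.\<close>
  have ker: "op_kernel Zt ?G = op_kernel Z G" "op_kernel Z G = op_kernel Zt G \<inter> op_kernel Zt Gt"
    by (auto simp: Z op_kernel_def zero_prod_def)
  \<comment> \<open>The boundary value of \<open>z\<close> is \<open>(G z, 0)\<close>. The square of
    \<open>norm (K z)\<close> is discarded and the inner product is estimated by
    Cauchy-Schwarz.\<close>
  have Kt_sq: "(norm (Kt z))\<^sup>2 \<le> (norm (G z))\<^sup>2 + 2 * (norm z * norm (L z))" if z: "z \<in> Z" for z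
  proof -
    have "2 * (z \<bullet> L z) + ((norm (K z))\<^sup>2 + (norm (Kt z))\<^sup>2) \<le> (norm (G z))\<^sup>2"
      using scattering_passive_node_dissipative[OF node, of z] z ZZt Z0[OF z] by (auto simp: norm_Pair)
    moreover have "\<bar>z \<bullet> L z\<bar> \<le> norm z * norm (L z)" by (rule Cauchy_Schwarz_ineq2)
    ultimately show ?thesis using zero_le_power2[of "norm (K z)"] by linarith
  qed
  \<comment> \<open>The mixed term is absorbed into squares, which bounds \<open>Kt\<close> on
    \<open>Z\<close> by the graph norm of the restricted triple.\<close>
  have Kt_le: "norm (Kt z) \<le> 2 * norm (z, G z, L z, K z)" if z: "z \<in> Z" for z
  proof (rule power2_le_imp_le)
    have "2 * (norm z * norm (L z)) \<le> (norm z)\<^sup>2 + (norm (L z))\<^sup>2"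
      using sum_squares_bound[of "norm z" "norm (L z)"] by (simp add: mult.assoc)
    with Kt_sq[OF z]
    show "(norm (Kt z))\<^sup>2 \<le> (2 * norm (z, G z, L z, K z))\<^sup>2"
      by (simp add: norm_Pair power_mult_distrib)
        (smt (verit) zero_le_power2)
  qed simp
  have clZ: "closed (op_graph Z (\<lambda>z. (G z, L z, K z)))"
    unfolding closed_sequential_limits
  proof (intro allI impI, elim conjE)
    fix p l assume p: "\<forall>n. p n \<in> op_graph Z (\<lambda>z. (G z, L z, K z))" and l: "p \<longlonglongrightarrow> l"
    define a where "a n = fst (p n)" for n
    have a: "a n \<in> Z" "p n = (a n, G (a n), L (a n), K (a n))" for n
      using p[rule_format, of n] by (auto simp: op_graph_def a_def)
    \<comment> \<open>Applied to differences, the bound makes \<open>Kt (a n)\<close> Cauchy, which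
      supplies the component that convergence of \<open>p\<close> leaves open.\<close>
    have le: "dist (Kt (a m)) (Kt (a n)) \<le> 2 * dist (p m) (p n)" for m n
      using Kt_le[OF subspace_diff[OF linear_operator_real(1)[OF lin(1)] a(1) a(1)], of m n] a
      by (simp add: lin[THEN linear_operator_real(4)] dist_norm)
    have "Cauchy (\<lambda>n. Kt (a n))"
    proof (rule metric_CauchyI)
      fix e :: real assume "0 < e"
      then obtain M where M: "\<And>m n. M \<le> m \<Longrightarrow> M \<le> n \<Longrightarrow> dist (p m) (p n) < e / 2"
        using metric_CauchyD[OF LIMSEQ_imp_Cauchy[OF l], of "e / 2"] by auto
      show "\<exists>M. \<forall>m\<ge>M. \<forall>n\<ge>M. dist (Kt (a m)) (Kt (a n)) < e"
      proof (intro exI allI impI)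
        fix m n assume "M \<le> m" "M \<le> n"
        then show "dist (Kt (a m)) (Kt (a n)) < e" using M[of m n] le[of m n] by simp
      qed
    qed
    then obtain v where v: "(\<lambda>n. Kt (a n)) \<longlonglongrightarrow> v"
      by (auto simp: Cauchy_convergent_iff convergent_def)
    obtain z u x y where zuxy: "l = (z, u, x, y)" by (cases l) auto
    have lim: "a \<longlonglongrightarrow> z" "(\<lambda>n. G (a n)) \<longlonglongrightarrow> u" "(\<lambda>n. L (a n)) \<longlonglongrightarrow> x" "(\<lambda>n. K (a n)) \<longlonglongrightarrow> y"
      using tendsto_fst[OF l] tendsto_fst[OF tendsto_snd[OF l]]
        tendsto_fst[OF tendsto_snd[OF tendsto_snd[OF l]]]
        tendsto_snd[OF tendsto_snd[OF tendsto_snd[OF l]]] by (simp_all add: a(2) zuxy)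
    \<comment> \<open>With \<open>Gt (a n) = 0\<close> and the limit \<open>v\<close> filled in, the
      sequence converges in the closed graph of the extended node. The limiting boundary component 0
      puts \<open>z\<close> into \<open>Z\<close>.\<close>
    have "(\<lambda>n. (a n, (G (a n), Gt (a n)), L (a n), K (a n), Kt (a n))) \<longlonglongrightarrow> (z, (u, 0), x, y, v)"
      using Z0[OF a(1)] by (intro tendsto_Pair lim v) simp
    then have "(z, (u, 0), x, y, v) \<in> op_graph Zt (\<lambda>z. (?G z, L z, ?K z))"
      by (rule closed_sequentially[OF cl, rotated]) (use a(1) ZZt in \<open>auto simp: op_graph_def\<close>)
    then show "l \<in> op_graph Z (\<lambda>z. (G z, L z, K z))"
      by (auto simp: op_graph_def zuxy Z op_kernel_def)
  qed
  have "u \<in> G ` Z" for u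
  proof -
    \<comment> \<open>A preimage of \<open>(u, 0)\<close> lies in the kernel of \<open>Gt\<close>,
      hence in \<open>Z\<close>.\<close>
    have "(u, 0) \<in> ?G ` Zt" using surj by simp
    then show ?thesis by (auto simp: Z op_kernel_def)
  qed
  then have surjZ: "G ` Z = UNIV" by auto
  have wpZ: "internally_well_posed_node Z G L K"
    unfolding internally_well_posed_node_def closed_operator_def linear_operator_Pair
    using lin clZ surjZ dense gen by (simp add: ker(1))
  have passZ: "scattering_passive_node Z G L K"
    unfolding scattering_passive_node_def
  proof (intro conjI allI impI wpZ)
    fix u z and t :: real assume sol: "smooth_solution Z G L K u z" and t: "0 \<le> t"
    have zZ: "z s \<in> Z" if "0 \<le> s" for s
      using sol that by (auto simp: smooth_solution_def continuous_into_solution_space_def)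
    \<comment> \<open>The two components to be added are \<open>Gt\<close>, which vanishes along the
      solution, and \<open>Kt\<close>, which is continuous by \<open>Kt_le\<close>.\<close>
    have "continuous_into_solution_space Zt ?G L ?K z"
      unfolding continuous_into_solution_space_def solution_space_norm_tendsto_0_iff
    proof (intro conjI allI impI)
      show "z s \<in> Zt" if "0 \<le> s" for s using zZ[OF that] ZZt by auto
      fix r :: real assume r: "0 \<le> r"
      let ?F = "at r within {0..}"
      have lims: "((\<lambda>s. z s - z r) \<longlongrightarrow> 0) ?F" "((\<lambda>s. L (z s - z r)) \<longlongrightarrow> 0) ?F"
        "((\<lambda>s. G (z s - z r)) \<longlongrightarrow> 0) ?F" "((\<lambda>s. K (z s - z r)) \<longlongrightarrow> 0) ?F"
        using sol r by (auto simp: smooth_solution_def continuous_into_solution_space_def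
            solution_space_norm_tendsto_0_iff)
      show "((\<lambda>s. z s - z r) \<longlongrightarrow> 0) ?F" "((\<lambda>s. L (z s - z r)) \<longlongrightarrow> 0) ?F" by fact+
      have ev: "\<forall>\<^sub>F s in ?F. z s - z r \<in> Z"
        unfolding eventually_at_filter
        by (intro always_eventually allI impI subspace_diff[OF linear_operator_real(1)[OF lin(1)]] zZ r) simp
      have "\<forall>\<^sub>F s in ?F. Gt (z s - z r) = 0" by (rule eventually_mono[OF ev]) (rule Z0)
      then show "((\<lambda>s. ?G (z s - z r)) \<longlongrightarrow> 0) ?F"
        unfolding zero_prod_def by (intro tendsto_Pair lims tendsto_eventually)
      have "((\<lambda>s. 2 * norm (z s - z r, G (z s - z r), L (z s - z r), K (z s - z r))) \<longlongrightarrow> 0) ?F"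
        by (intro tendsto_mult_right_zero tendsto_norm_zero)
          (auto simp: zero_prod_def intro!: tendsto_Pair lims)
      then have "((\<lambda>s. Kt (z s - z r)) \<longlongrightarrow> 0) ?F"
        by (rule Lim_null_comparison[rotated]) (rule eventually_mono[OF ev], rule Kt_le)
      then show "((\<lambda>s. ?K (z s - z r)) \<longlongrightarrow> 0) ?F"
        unfolding zero_prod_def by (intro tendsto_Pair lims)
    qed
    moreover have "Cn_halfline 2 (\<lambda>s. (u s, 0 :: 'ut))"
    proof -
      obtain u' u'' where "\<forall>t\<ge>0. (u has_vector_derivative u' t) (at t within {0..})"
        "\<forall>t\<ge>0. (u' has_vector_derivative u'' t) (at t within {0..})" "continuous_on {0..} u''"
        using sol by (auto simp: smooth_solution_def numeral_2_eq_2)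
      then show ?thesis
        unfolding numeral_2_eq_2 Cn_halfline.simps
        by (intro exI[of _ "\<lambda>s. (u' s, 0)"] exI[of _ "\<lambda>s. (u'' s, 0)"] conjI allI impI
            has_vector_derivative_Pair continuous_on_Pair) auto
    qed
    ultimately have "smooth_solution Zt ?G L ?K (\<lambda>s. (u s, 0)) z"
      using sol zZ Z0 by (auto simp: smooth_solution_def)
    from pass[OF this] t
    obtain d where d: "((\<lambda>s. (norm (z s))\<^sup>2) has_real_derivative d) (at t within {0..})"
      "d + (norm (?K (z t)))\<^sup>2 \<le> (norm (u t, 0 :: 'ut))\<^sup>2" by blast
    \<comment> \<open>The input \<open>(u t, 0)\<close> has the norm of \<open>u t\<close>, and the
      nonnegative contribution of \<open>Kt\<close> is dropped.\<close>
    have "d + (norm (K (z t)))\<^sup>2 \<le> (norm (u t))\<^sup>2"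
      using d(2) by (simp add: norm_Pair) (smt (verit) zero_le_power2)
    with d(1) show "\<exists>d. ((\<lambda>s. (norm (z s))\<^sup>2) has_real_derivative d) (at t within {0..}) \<and>
        d + (norm (K (z t)))\<^sup>2 \<le> (norm (u t))\<^sup>2"
      by blast
  qed
  have strong: "strong_node Z G L K" if "strong_node Zt ?G L ?K"
  proof -
    have clL: "closed (op_graph Zt L)" using that by (simp add: strong_node_def closed_operator_def)
    have "op_graph Zt (\<lambda>z. (L z, ?G z, ?K z)) =
        (\<lambda>p. (fst p, fst (snd (snd p)), fst (snd p), snd (snd (snd p)))) -` op_graph Zt (\<lambda>z. (?G z, L z, ?K z))"
      by (force simp: op_graph_def)
    then have "closed (op_graph Zt (\<lambda>z. (L z, ?G z, ?K z)))"
      by (auto intro!: closed_vimage[OF cl] continuous_intros)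
    \<comment> \<open>Since \<open>L\<close> is closed on all of \<open>Zt\<close>, its graph norm
      dominates every boundary and output map there, in particular \<open>Gt\<close>.\<close>
    then obtain C where "\<And>z. z \<in> Zt \<Longrightarrow> norm (?G z, ?K z) \<le> C * norm (z, L z)"
      using relatively_bounded[OF L _ clL, of "\<lambda>z. (?G z, ?K z)"] G Gt K Kt
      by (auto simp: linear_operator_Pair)
    moreover have "norm (Gt z) \<le> norm (?G z, ?K z)" for z
      by (rule order_trans[OF norm_snd_le norm_fst_le])
    ultimately have C: "norm (Gt z) \<le> C * norm (z, L z)" if "z \<in> Zt" for z
      using that order_trans by blast
    have "closed (op_graph Z L)"
      unfolding closed_sequential_limits
    proof (intro allI impI, elim conjE)
      fix p l assume p: "\<forall>n. p n \<in> op_graph Z L" and l: "p \<longlonglongrightarrow> l"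
      define a where "a n = fst (p n)" for n
      have a: "a n \<in> Z" "p n = (a n, L (a n))" for n
        using p[rule_format, of n] by (auto simp: op_graph_def a_def)
      have "l \<in> op_graph Zt L"
        by (rule closed_sequentially[OF clL _ l]) (use p ZZt in \<open>auto simp: op_graph_def\<close>)
      then obtain z where z: "z \<in> Zt" "l = (z, L z)" by (auto simp: op_graph_def)
      \<comment> \<open>Because \<open>Gt (a n) = 0\<close>, the value \<open>Gt z\<close> equals
        \<open>Gt (z - a n)\<close>, which is bounded by the distance of \<open>l\<close> and
        \<open>p n\<close> in the graph of \<open>L\<close>.\<close>
      have "norm (Gt z) \<le> C * norm (l - p n)" for n
        using C[OF subspace_diff[OF linear_operator_real(1)[OF L] z(1)], of "a n"] a ZZt z Z0[OF a(1)[of n]]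
          linear_operator_real(4)[OF L z(1)] linear_operator_real(4)[OF Gt z(1)] by (simp add: subset_iff)
      moreover have "(\<lambda>n. C * norm (l - p n)) \<longlonglongrightarrow> C * norm (l - l)"
        by (intro tendsto_intros l)
      ultimately have "norm (Gt z) \<le> 0" using LIMSEQ_le_const by fastforce
      then show "l \<in> op_graph Z L" using z by (auto simp: op_graph_def Z op_kernel_def)
    qed
    then show ?thesis using wpZ lin by (simp add: strong_node_def closed_operator_def)
  qed
  show ?thesis
    using passZ strong ker by (simp add: semigroup_generator_def)
qed

end
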